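(* Let $r\ge 2$ and let $H$ be a connected $r$-uniform linear hypergraph on $n$ vertices, with at least one edge, with spectral radius $\rho$ and principal eigenvector $x$. Let $\delta$ be the minimum vertex degree of $H$ and let $x_{\min}$ be the minimum entry of $x$. Then $$x_{\min}\le \frac{1}{\left((r-1)\left(\frac{\rho^r}{\delta}\right)^{\frac{1}{r-1}}+n-\delta(r-1)\right)^{1/r}}.$$
   Context: A hypergraph $H=(V(H),E(H))$ on $n$ vertices has vertex set $V(H)=[n]=\{1,\dots,n\}$ (after labelling) and a set $E(H)$ of edges, which are subsets of $V(H)$; it is $r$-uniform if every edge contains exactly $r$ vertices. It is linear if any two distinct edges have at most one common vertex. The degree of a vertex is the number of edges containing it. A path is an alternating sequence $v_1e_1v_2e_2\cdots v_\ell e_\ell v_{\ell+1}$ with $v_i,v_{i+1}\in e_i$ for $1\le i\le \ell$, all vertices and all edges in it being distinct; $H$ is connected if any two vertices are joined by a path. The adjacency tensor $\mathcal{A}(H)$ is the order $r$, dimension $n$ tensor whose $(i_1i_2\cdots i_r)$-entry is $\frac{1}{(r-1)!}$ if $\{i_1,\dots,i_r\}\in E(H)$ and $0$ otherwise. For an order $r$ dimension $n$ tensor $\mathcal{A}=(a_{i_1\cdots i_r})$ and $x\in\mathbb{C}^n$, $\mathcal{A}x$ is the vector in $\mathbb{C}^n$ with $(\mathcal{A}x)_i=\sum_{i_2,\dots,i_r=1}^n a_{ii_2\cdots i_r}x_{i_2}\cdots x_{i_r}$. A number $\lambda\in\mathbb{C}$ is an eigenvalue of $\mathcal{A}$ with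 eigenvector $x\neq 0$ if $(\mathcal{A}x)_i=\lambda x_i^{r-1}$ for all $i$. The spectral radius $\rho(H)$ is the maximum modulus of the eigenvalues of $\mathcal{A}(H)$. For connected $H$, the principal eigenvector of $H$ is the unique eigenvector $x$ of $\mathcal{A}(H)$ corresponding to $\rho(H)$ with all entries positive and $\|x\|_r=\left(\sum_i x_i^r\right)^{1/r}=1$. *)

theory Defs
  imports "HOL-Analysis.Analysis"
begin

text \<open>
  A hypergraph on \<open>n\<close> vertices has all elements of a finite type \<open>'n\<close> as its vertices, with
  \<open>n = CARD('n)\<close>, and is given by its edge set.
\<close>

type_synonym 'n hypergraph = "'n set set"

definition uniform_hypergraph :: "nat \<Rightarrow> 'n::finite hypergraph \<Rightarrow> bool" where
  "uniform_hypergraph r H \<longleftrightarrow> (\<forall>e\<in>H. card e = r)"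

definition linear_hypergraph :: "'n::finite hypergraph \<Rightarrow> bool" where
  "linear_hypergraph H \<longleftrightarrow> (\<forall>e\<in>H. \<forall>f\<in>H. e \<noteq> f \<longrightarrow> card (e \<inter> f) \<le> 1)"

definition vertex_degree :: "'n::finite hypergraph \<Rightarrow> 'n \<Rightarrow> nat" where
  "vertex_degree H v = card {e \<in> H. v \<in> e}"

definition min_degree :: "'n::finite hypergraph \<Rightarrow> nat" where
  "min_degree H = Min (range (vertex_degree H))"

text \<open>
  The path \<open>v\<^sub>1 e\<^sub>1 v\<^sub>2 \<dots> v\<^sub>l e\<^sub>l v\<^sub>l\<^sub>+\<^sub>1\<close> is split into its list \<open>vs\<close> of vertices and its list \<open>es\<close> of edges.
\<close>

definition hypergraph_path :: "'n hypergraph \<Rightarrow> 'n list \<Rightarrow> 'n set list \<Rightarrow> bool" where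
  "hypergraph_path H vs es \<longleftrightarrow>
     length vs = length es + 1 \<and> set es \<subseteq> H \<and> distinct vs \<and> distinct es \<and>
     (\<forall>i<length es. vs ! i \<in> es ! i \<and> vs ! (i + 1) \<in> es ! i)"

definition connected_hypergraph :: "'n hypergraph \<Rightarrow> bool" where
  "connected_hypergraph H \<longleftrightarrow>
     (\<forall>u v. u \<noteq> v \<longrightarrow> (\<exists>vs es. hypergraph_path H vs es \<and> hd vs = u \<and> last vs = v))"

text \<open>
  A tensor of order \<open>r\<close> and dimension \<open>CARD('n)\<close> is a function on index lists; only its values on
  lists of length \<open>r\<close> are ever used.
\<close>

type_synonym 'n tensor = "'n list \<Rightarrow> complex"

definition tensor_apply :: "nat \<Rightarrow> 'n::finite tensor \<Rightarrow> complex ^ 'n \<Rightarrow> complex ^ 'n" where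
  "tensor_apply r A x =
     (\<chi> i. \<Sum>js | length js = r - 1. A (i # js) * (\<Prod>j\<leftarrow>js. x $ j))"

definition tensor_eigenvector ::
    "nat \<Rightarrow> 'n::finite tensor \<Rightarrow> complex ^ 'n \<Rightarrow> complex \<Rightarrow> bool" where
  "tensor_eigenvector r A x \<mu> \<longleftrightarrow>
     x \<noteq> 0 \<and> (\<forall>i. tensor_apply r A x $ i = \<mu> * (x $ i) ^ (r - 1))"

definition tensor_eigenvalue :: "nat \<Rightarrow> 'n::finite tensor \<Rightarrow> complex \<Rightarrow> bool" where
  "tensor_eigenvalue r A \<mu> \<longleftrightarrow> (\<exists>x. tensor_eigenvector r A x \<mu>)"

definition adjacency_tensor :: "nat \<Rightarrow> 'n hypergraph \<Rightarrow> 'n tensor" where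
  "adjacency_tensor r H is = (if set is \<in> H then 1 / fact (r - 1) else 0)"

text \<open>
  The maximum is taken with \<open>GREATEST\<close> and not with \<open>Max\<close>, so that it means what it should without a
  proof that the set of eigenvalues is finite.
\<close>

definition hypergraph_spectral_radius :: "nat \<Rightarrow> 'n::finite hypergraph \<Rightarrow> real" where
  "hypergraph_spectral_radius r H =
     (GREATEST t. \<exists>\<mu>. tensor_eigenvalue r (adjacency_tensor r H) \<mu> \<and> t = cmod \<mu>)"

definition principal_eigenvector :: "nat \<Rightarrow> 'n::finite hypergraph \<Rightarrow> real ^ 'n \<Rightarrow> bool" where
  "principal_eigenvector r H x \<longleftrightarrow>
     tensor_eigenvector r (adjacency_tensor r H) (\<chi> i. complex_of_real (x $ i))
       (complex_of_real (hypergraph_spectral_radius r H)) \<and>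
     (\<forall>i. x $ i > 0) \<and>
     (\<Sum>i\<in>UNIV. (x $ i) ^ r) powr (1 / real r) = 1"

end

theory Submission
  imports Defs "HOL-Combinatorics.Multiset_Permutations"
begin

text \<open>
  The bound comes from the eigenvalue equation at a vertex \<open>v\<close> of minimum degree. Let \<open>d\<close> be the
  degree of \<open>v\<close>. At \<open>v\<close> the equation reads \<open>\<rho> x\<^sub>v\<^bsup>r-1\<^esup> = \<Sum>\<^sub>e t\<^sub>e\<close>, where \<open>e\<close> runs over the \<open>d\<close> edges through \<open>v\<close>
  and \<open>t\<^sub>e\<close> is the product of the entries of \<open>x\<close> over \<open>e - {v}\<close>
  (\<open>tensor_apply_adjacency_tensor\<close>). Put \<open>p = r / (r-1)\<close>. The inequality between arithmetic and
  geometric mean in each edge gives \<open>(r-1) t\<^sub>e\<^sup>p \<le> \<Sum>\<^bsub>j\<in>e-{v}\<^esub> x\<^sub>j\<^sup>r\<close>, and convexity of the \<open>p\<close>-th power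
  bounds \<open>\<Sum>\<^sub>e t\<^sub>e\<^sup>p\<close> from below by \<open>d (\<rho> x\<^sub>v\<^bsup>r-1\<^esup> / d)\<^sup>p\<close>. In a linear hypergraph the sets \<open>e - {v}\<close>
  are pairwise disjoint, so summing over \<open>e\<close> counts each neighbour of \<open>v\<close> once, and there are
  \<open>d (r-1)\<close> neighbours. Hence the neighbours together carry at least
  \<open>(r-1) (\<rho>\<^sup>r / d)\<^bsup>1/(r-1)\<^esup> x\<^sub>v\<^sup>r\<close> of the total mass \<open>\<Sum>\<^sub>j x\<^sub>j\<^sup>r = 1\<close> (\<open>neighbourhood_mass\<close>).

  Each of the other \<open>n - d (r-1)\<close> vertices carries at least \<open>x\<^sub>m\<^sub>i\<^sub>n\<^sup>r\<close>, and \<open>x\<^sub>v \<ge> x\<^sub>m\<^sub>i\<^sub>n\<close>. Adding up gives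
  \<open>x\<^sub>m\<^sub>i\<^sub>n\<^sup>r D \<le> 1\<close>, where \<open>D\<close> is the expression under the \<open>r\<close>-th root.
\<close>

section \<open>The eigenvalue equation of a uniform hypergraph\<close>

text \<open>
  An index list that contributes to the entry at \<open>i\<close> enumerates, together with \<open>i\<close>, the \<open>r\<close> vertices
  of an edge in \<open>r\<close> places. It therefore has no repetitions and is an ordering of \<open>e - {i}\<close>; the
  \<open>(r-1)!\<close> such orderings cancel the weight of the tensor.
\<close>

lemma tensor_apply_adjacency_tensor:
  fixes H :: "'n::finite hypergraph"
  assumes r: "r \<ge> 1" and unif: "uniform_hypergraph r H"
  shows "tensor_apply r (adjacency_tensor r H) x $ i =
           (\<Sum>e\<in>{e \<in> H. i \<in> e}. \<Prod>j\<in>e - {i}. x $ j)"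
proof -
  define E where "E = {e \<in> H. i \<in> e}"
  define S where "S = {js :: 'n list. length js = r - 1 \<and> insert i (set js) \<in> H}"
  define w where "w = (\<lambda>js. (1 / fact (r - 1)) * (\<Prod>j\<leftarrow>js. x $ j))"
  have fin: "finite {js :: 'n list. length js = r - 1}"
    using finite_lists_length_eq[of "UNIV :: 'n set" "r - 1"] by simp
  have finS: "finite S"
    by (rule finite_subset[OF _ fin]) (auto simp: S_def)
  have fibre: "{js. js \<in> S \<and> insert i (set js) = e} = permutations_of_set (e - {i})"
    if e: "e \<in> E" for e
  proof -
    have ce: "card e = r" and ie: "i \<in> e" and eH: "e \<in> H"
      using e unif by (auto simp: E_def uniform_hypergraph_def)
    have cd: "card (e - {i}) = r - 1"
      using ce ie by simp
    show ?thesis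
    proof (intro equalityI subsetI)
      fix js assume "js \<in> {js. js \<in> S \<and> insert i (set js) = e}"
      then have l: "length js = r - 1" and ins: "insert i (set js) = e"
        by (auto simp: S_def)
      have le: "card (set js) \<le> r - 1"
        using card_length[of js] l by simp
      have ni: "i \<notin> set js"
      proof
        assume "i \<in> set js"
        then have "e = set js" using ins by auto
        then show False using ce le r by simp
      qed
      then have s: "set js = e - {i}" using ins by auto
      then have "distinct js" using cd l by (simp add: card_distinct)
      then show "js \<in> permutations_of_set (e - {i})" using s by auto
    next
      fix js assume js: "js \<in> permutations_of_set (e - {i})"
      then have "set js = e - {i}" "distinct js"
        by (auto dest: permutations_of_setD)
      then show "js \<in> {js. js \<in> S \<and> insert i (set js) = e}"
        using cd ie eH distinct_card[of js] by (auto simp: S_def insert_absorb)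
    qed
  qed
  have "tensor_apply r (adjacency_tensor r H) x $ i =
      (\<Sum>js | length js = r - 1. adjacency_tensor r H (i # js) * (\<Prod>j\<leftarrow>js. x $ j))"
    by (simp add: tensor_apply_def)
  also have "\<dots> = (\<Sum>js\<in>S. w js)"
    by (rule sum.mono_neutral_cong_right[OF fin])
       (auto simp: S_def w_def adjacency_tensor_def)
  also have "\<dots> = (\<Sum>e\<in>E. \<Sum>js | js \<in> S \<and> insert i (set js) = e. w js)"
    by (rule sum.group[symmetric, OF finS]) (auto simp: E_def S_def)
  also have "\<dots> = (\<Sum>e\<in>E. \<Prod>j\<in>e - {i}. x $ j)"
  proof (rule sum.cong[OF refl])
    fix e assume e: "e \<in> E"
    have cd: "card (e - {i}) = r - 1"
      using e unif by (auto simp: E_def uniform_hypergraph_def)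
    have "(\<Sum>js | js \<in> S \<and> insert i (set js) = e. w js) =
        (\<Sum>js\<in>permutations_of_set (e - {i}). (1 / fact (r - 1)) * (\<Prod>j\<in>e - {i}. x $ j))"
      unfolding fibre[OF e]
    proof (rule sum.cong[OF refl])
      fix js assume "js \<in> permutations_of_set (e - {i})"
      then have s: "set js = e - {i}" and dis: "distinct js"
        by (auto dest: permutations_of_setD)
      show "w js = (1 / fact (r - 1)) * (\<Prod>j\<in>e - {i}. x $ j)"
        using prod.distinct_set_conv_list[OF dis, of "\<lambda>j. x $ j"] by (simp add: w_def s)
    qed
    also have "\<dots> = (\<Prod>j\<in>e - {i}. x $ j)"
      by (simp add: cd)
    finally show "(\<Sum>js | js \<in> S \<and> insert i (set js) = e. w js) = (\<Prod>j\<in>e - {i}. x $ j)" .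
  qed
  finally show ?thesis
    by (simp add: E_def)
qed

lemma principal_eigenvector_equation:
  fixes H :: "'n::finite hypergraph"
  assumes r: "r \<ge> 1" and unif: "uniform_hypergraph r H" and pe: "principal_eigenvector r H x"
  shows "(\<Sum>e\<in>{e \<in> H. i \<in> e}. \<Prod>j\<in>e - {i}. x $ j) =
           hypergraph_spectral_radius r H * (x $ i) ^ (r - 1)"
proof -
  have "complex_of_real (\<Sum>e\<in>{e \<in> H. i \<in> e}. \<Prod>j\<in>e - {i}. x $ j) =
      complex_of_real (hypergraph_spectral_radius r H * (x $ i) ^ (r - 1))"
    using pe tensor_apply_adjacency_tensor[OF r unif, of "\<chi> i. complex_of_real (x $ i)" i]
    by (simp add: principal_eigenvector_def tensor_eigenvector_def)
  then show ?thesis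
    by (rule of_real_eq_iff[THEN iffD1])
qed

section \<open>Two mean inequalities\<close>

lemma card_mult_prod_powr_le_sum_power:
  fixes x :: "'a \<Rightarrow> real"
  assumes fin: "finite T" and ne: "T \<noteq> {}" and pos: "\<And>j. j \<in> T \<Longrightarrow> x j > 0"
  shows "real (card T) * (\<Prod>j\<in>T. x j) powr (real r / real (card T)) \<le> (\<Sum>j\<in>T. x j ^ r)"
proof -
  have c: "real (card T) > 0" using fin ne by (simp add: card_gt_0_iff)
  have P: "(\<Prod>j\<in>T. x j) > 0" using pos by (simp add: prod_pos)
  have "(\<Prod>j\<in>T. x j ^ r) powr (1 / card T) \<le> (\<Sum>j\<in>T. x j ^ r / card T)"
    by (rule arith_geom_mean) (use fin ne pos in \<open>auto simp: less_imp_le\<close>)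
  also have "(\<Prod>j\<in>T. x j ^ r) = (\<Prod>j\<in>T. x j) powr r"
    using P by (simp add: prod_power_distrib powr_realpow)
  also have "(\<Sum>j\<in>T. x j ^ r / card T) = (\<Sum>j\<in>T. x j ^ r) / card T"
    by (simp add: sum_divide_distrib)
  finally show ?thesis
    using c by (simp add: powr_powr field_simps)
qed

lemma card_mult_mean_powr_le_sum_powr:
  fixes t :: "'a \<Rightarrow> real"
  assumes fin: "finite S" and ne: "S \<noteq> {}" and pos: "\<And>e. e \<in> S \<Longrightarrow> t e > 0" and p: "p \<ge> 1"
  shows "real (card S) * ((\<Sum>e\<in>S. t e) / real (card S)) powr p \<le> (\<Sum>e\<in>S. t e powr p)"
proof -
  have c: "real (card S) > 0" using fin ne by (simp add: card_gt_0_iff)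
  have "(\<Sum>e\<in>S. (1 / card S) *\<^sub>R t e) powr p \<le> (\<Sum>e\<in>S. (1 / card S) * (t e powr p))"
    by (rule convex_on_sum[OF fin ne powr_convex[OF p]]) (use c pos in auto)
  then have "((\<Sum>e\<in>S. t e) / card S) powr p \<le> (\<Sum>e\<in>S. t e powr p) / card S"
    by (simp add: sum_divide_distrib)
  then show ?thesis
    using c by (simp add: field_simps)
qed

section \<open>The mass of the neighbourhood of a vertex\<close>

text \<open>In a linear hypergraph two edges through \<open>v\<close> meet only in \<open>v\<close>.\<close>

lemma linear_links_disjoint:
  fixes H :: "'n::finite hypergraph"
  assumes lin: "linear_hypergraph H" and ef: "e \<in> H" "f \<in> H" "v \<in> e" "v \<in> f" "e \<noteq> f"
  shows "(e - {v}) \<inter> (f - {v}) = {}"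
proof (rule ccontr)
  assume "(e - {v}) \<inter> (f - {v}) \<noteq> {}"
  then obtain u where u: "u \<in> e" "u \<in> f" "u \<noteq> v" by auto
  have "card {u, v} \<le> card (e \<inter> f)"
    by (rule card_mono) (use u ef in auto)
  then have "card (e \<inter> f) \<ge> 2"
    using u by simp
  moreover have "card (e \<inter> f) \<le> 1"
    using lin ef unfolding linear_hypergraph_def by blast
  ultimately show False
    by simp
qed

lemma card_linear_neighbourhood:
  fixes H :: "'n::finite hypergraph"
  assumes unif: "uniform_hypergraph r H" and lin: "linear_hypergraph H"
  shows "card (\<Union>e\<in>{e \<in> H. v \<in> e}. e - {v}) = vertex_degree H v * (r - 1)"
proof -
  have "card (\<Union>e\<in>{e \<in> H. v \<in> e}. e - {v}) = (\<Sum>e\<in>{e \<in> H. v \<in> e}. card (e - {v}))"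
    by (rule card_UN_disjoint) (auto dest: linear_links_disjoint[OF lin])
  also have "\<dots> = (\<Sum>e\<in>{e \<in> H. v \<in> e}. r - 1)"
    by (rule sum.cong) (use unif in \<open>auto simp: uniform_hypergraph_def\<close>)
  finally show ?thesis
    by (simp add: vertex_degree_def)
qed

text \<open>
  Convexity makes the mass smallest when all edges through \<open>v\<close> have the same product, and the mean
  inequality makes it smallest when the entries within each edge agree; the bound is the mass in
  that extremal configuration.
\<close>

lemma neighbourhood_mass:
  fixes H :: "'n::finite hypergraph" and x :: "real ^ 'n"
  assumes r: "r \<ge> 2" and unif: "uniform_hypergraph r H" and lin: "linear_hypergraph H"
    and pos: "\<And>i. x $ i > 0"
    and eq: "(\<Sum>e\<in>{e \<in> H. v \<in> e}. \<Prod>j\<in>e - {v}. x $ j) = \<rho> * (x $ v) ^ (r - 1)"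
  shows "(real r - 1) * (\<rho> ^ r / real (vertex_degree H v)) powr (1 / (real r - 1)) * (x $ v) ^ r
           \<le> (\<Sum>j\<in>(\<Union>e\<in>{e \<in> H. v \<in> e}. e - {v}). (x $ j) ^ r)"
proof (cases "vertex_degree H v = 0")
  case True
  \<comment> \<open>Division by zero makes the left-hand side zero.\<close>
  then show ?thesis
    using pos by (simp add: sum_nonneg less_imp_le)
next
  case False
  define E where "E = {e \<in> H. v \<in> e}"
  define t where "t = (\<lambda>e. \<Prod>j\<in>e - {v}. x $ j)"
  define d where "d = real (card E)"
  define q where "q = 1 / (real r - 1)"
  define p where "p = real r / (real r - 1)"
  have r1: "real r - 1 > 0" and q: "q > 0" and p: "p = 1 + q"
    using r by (auto simp: p_def q_def field_simps)
  have ne: "E \<noteq> {}" and d: "d > 0"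
    using False by (auto simp: E_def d_def vertex_degree_def card_gt_0_iff)
  have t: "t e > 0" for e
    unfolding t_def using pos by (simp add: prod_pos)
  have ce: "card (e - {v}) = r - 1" if "e \<in> E" for e
    using that unif by (auto simp: E_def uniform_hypergraph_def)
  have xv: "x $ v > 0" by (rule pos)
  have S: "(\<Sum>e\<in>E. t e) = \<rho> * (x $ v) ^ (r - 1)"
    using eq by (simp add: E_def t_def)
  have "(\<Sum>e\<in>E. t e) > 0"
    by (rule sum_pos) (use ne t in auto)
  then have \<rho>: "\<rho> > 0"
    using S xv by (simp add: zero_less_mult_iff)
  have xvp: "((x $ v) ^ (r - 1)) powr p = (x $ v) ^ r"
  proof -
    have "((x $ v) ^ (r - 1)) powr p = (x $ v) powr (real (r - 1) * p)"
      using xv by (simp add: powr_realpow[symmetric] powr_powr)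
    also have "real (r - 1) * p = real r"
      using r r1 by (simp add: p_def of_nat_diff)
    finally show ?thesis
      using xv by (simp add: powr_realpow)
  qed
  have \<rho>p: "(\<rho> ^ r) powr q = \<rho> powr p"
    using \<rho> by (simp add: powr_realpow[symmetric] powr_powr p_def q_def)
  have "(\<rho> ^ r / d) powr q * (x $ v) ^ r = d * ((\<rho> * (x $ v) ^ (r - 1)) / d) powr p"
    using \<rho> d xv xvp \<rho>p
    by (simp add: powr_divide powr_mult) (simp add: p powr_add field_simps)
  also have "\<dots> \<le> (\<Sum>e\<in>E. t e powr p)"
    using card_mult_mean_powr_le_sum_powr[of E t p] ne t q S by (simp add: d_def p)
  finally have "(real r - 1) * ((\<rho> ^ r / d) powr q * (x $ v) ^ r) \<le> (real r - 1) * (\<Sum>e\<in>E. t e powr p)"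
    using r1 by (intro mult_left_mono) auto
  also have "\<dots> = (\<Sum>e\<in>E. (real r - 1) * t e powr p)"
    by (rule sum_distrib_left)
  also have "\<dots> \<le> (\<Sum>e\<in>E. \<Sum>j\<in>e - {v}. (x $ j) ^ r)"
  proof (rule sum_mono)
    fix e assume e: "e \<in> E"
    have "e - {v} \<noteq> {}"
      using ce[OF e] r by (metis card.empty diff_is_0_eq not_less_eq_eq numeral_2_eq_2 One_nat_def)
    then show "(real r - 1) * t e powr p \<le> (\<Sum>j\<in>e - {v}. (x $ j) ^ r)"
      using card_mult_prod_powr_le_sum_power[of "e - {v}" "\<lambda>j. x $ j" r] ce[OF e] r pos
      by (simp add: t_def p_def of_nat_diff)
  qed
  also have "\<dots> = (\<Sum>j\<in>(\<Union>e\<in>E. e - {v}). (x $ j) ^ r)"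
    by (rule sum.UNION_disjoint[symmetric]) (auto simp: E_def dest: linear_links_disjoint[OF lin])
  finally show ?thesis
    by (simp add: E_def d_def q_def vertex_degree_def mult.assoc)
qed

section \<open>The bound on the smallest entry\<close>

theorem theorem3p2:
  fixes H :: "'n::finite hypergraph" and x :: "real ^ 'n" and r n \<delta> :: nat and \<rho> xmin :: real
  assumes "r \<ge> 2"
    and "n = CARD('n)"
    and "uniform_hypergraph r H"
    and "linear_hypergraph H"
    and "connected_hypergraph H"
    and "H \<noteq> {}"
    and "\<rho> = hypergraph_spectral_radius r H"
    and "principal_eigenvector r H x"
    and "\<delta> = min_degree H"
    and "xmin = Min (range (\<lambda>i. x $ i))"
  shows "xmin \<le> 1 / (((real r - 1) * (\<rho> ^ r / real \<delta>) powr (1 / (real r - 1))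
                        + real n - real \<delta> * (real r - 1)) powr (1 / real r))"
proof -
  have r: "r \<ge> 2" and r1: "real (r - 1) = real r - 1"
    using assms(1) by auto
  have pos: "x $ i > 0" for i
    using assms(8) by (simp add: principal_eigenvector_def)
  have total: "(\<Sum>i\<in>UNIV. (x $ i) ^ r) = 1"
  proof -
    have "(\<Sum>i\<in>UNIV. (x $ i) ^ r) > 0"
      by (rule sum_pos) (use pos in auto)
    moreover have "(\<Sum>i\<in>UNIV. (x $ i) ^ r) powr (1 / real r) = 1"
      using assms(8) by (simp add: principal_eigenvector_def)
    ultimately show ?thesis
      using r powr_eq_one_iff_gen[of "\<Sum>i\<in>UNIV. (x $ i) ^ r" "1 / real r"] by auto
  qed
  have xmin_le: "xmin \<le> x $ i" for i
    using assms(10) by simp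
  have "xmin \<in> range (\<lambda>i. x $ i)"
    unfolding assms(10) by (rule Min_in) auto
  then have xmin_pos: "xmin > 0"
    using pos by auto
  have "\<delta> \<in> range (vertex_degree H)"
    unfolding assms(9) min_degree_def by (rule Min_in) auto
  then obtain v where v: "\<delta> = vertex_degree H v"
    by auto
  define N where "N = (\<Union>e\<in>{e \<in> H. v \<in> e}. e - {v})"
  define M where "M = (real r - 1) * (\<rho> ^ r / real \<delta>) powr (1 / (real r - 1))"
  define D where "D = M + real n - real \<delta> * (real r - 1)"
  have M: "M \<ge> 0"
    using r by (simp add: M_def)
  have cN: "real (card N) = real \<delta> * (real r - 1)"
    unfolding N_def card_linear_neighbourhood[OF assms(3,4)] v of_nat_mult r1 ..
  have cNc: "real (card (- N)) = real n - real \<delta> * (real r - 1)"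
    using card_Diff_subset[of N UNIV] card_mono[of UNIV N] cN assms(2)
    by (simp add: Compl_eq_Diff_UNIV of_nat_diff)
  \<comment> \<open>The vertex \<open>v\<close> itself lies outside \<open>N\<close>, which makes the root in the denominator positive.\<close>
  have "v \<in> - N"
    by (simp add: N_def)
  then have "card (- N) > 0"
    by (auto simp: card_gt_0_iff)
  then have D: "D > 0"
    using M cNc by (simp add: D_def)
  have "M * xmin ^ r \<le> M * (x $ v) ^ r"
    using M xmin_pos xmin_le by (intro mult_left_mono power_mono) auto
  also have "\<dots> \<le> (\<Sum>j\<in>N. (x $ j) ^ r)"
    using neighbourhood_mass[OF r assms(3,4) pos, of v \<rho>]
      principal_eigenvector_equation[OF _ assms(3,8), of v] r
    by (simp add: M_def N_def v assms(7))
  finally have inside: "M * xmin ^ r \<le> (\<Sum>j\<in>N. (x $ j) ^ r)" .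
  have "real (card (- N)) * xmin ^ r = (\<Sum>j\<in>- N. xmin ^ r)"
    by simp
  also have "\<dots> \<le> (\<Sum>j\<in>- N. (x $ j) ^ r)"
    using xmin_pos xmin_le by (intro sum_mono power_mono) auto
  finally have outside: "real (card (- N)) * xmin ^ r \<le> (\<Sum>j\<in>- N. (x $ j) ^ r)" .
  have "(\<Sum>j\<in>N. (x $ j) ^ r) + (\<Sum>j\<in>- N. (x $ j) ^ r) = 1"
    using total sum.subset_diff[of N UNIV "\<lambda>j. (x $ j) ^ r"] by (simp add: Compl_eq_Diff_UNIV)
  moreover have "D * xmin ^ r = M * xmin ^ r + real (card (- N)) * xmin ^ r"
    by (simp add: D_def cNc algebra_simps)
  ultimately have "D * xmin ^ r \<le> 1"
    using inside outside by linarith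
  then have "(D * xmin ^ r) powr (1 / real r) \<le> 1 powr (1 / real r)"
    using D xmin_pos by (intro powr_mono2) auto
  moreover have "(xmin ^ r) powr (1 / real r) = xmin"
    using xmin_pos r by (simp add: powr_realpow[symmetric] powr_powr)
  ultimately have "D powr (1 / real r) * xmin \<le> 1"
    using D xmin_pos by (simp add: powr_mult)
  then have "xmin \<le> 1 / D powr (1 / real r)"
    using D by (simp add: field_simps)
  then show ?thesis
    by (simp add: D_def M_def)
qed

end
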